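(* Let $R$ and $R'$ be rings and let $\varphi:R\to R'$ be a Jordan homomorphism. If $\varphi$ is splittable, then $\varphi$ is the sum of a homomorphism and an antihomomorphism on the commutator ideal $K$ of $R$.
   Context: Rings are associative and not necessarily unital; ideals are two-sided, and the ideal generated by a set is the smallest ideal containing it. Homomorphisms and antihomomorphisms are additive maps with $\alpha(xy)=\alpha(x)\alpha(y)$, respectively $\alpha(xy)=\alpha(y)\alpha(x)$. An additive map $\varphi:R\to R'$ is a Jordan homomorphism if $\varphi(x^2)=\varphi(x)^2$ and $\varphi(xyx)=\varphi(x)\varphi(y)\varphi(x)$ for all $x,y\in R$. Let $R_\varphi'$ denote the subring of $R'$ generated by $\varphi(R)$. Let $V_\varphi$ be the ideal of $R_\varphi'$ generated by all $\varphi(xy)-\varphi(x)\varphi(y)$, $x,y\in R$, and let $W_\varphi$ be the ideal of $R_\varphi'$ generated by all $\varphi(xy)-\varphi(y)\varphi(x)$, $x,y\in R$. The Jordan homomorphism $\varphi$ is splittable if $V_\varphi\cap W_\varphi=\{0\}$. The commutator ideal $K$ of $R$ is the ideal of $R$ generated by all $[x,y]=xy-yx$, $x,y\in R$. Let $I$ be an ideal of $R$. A Jordan homomorphism $\varphi:R\to R'$ is the sum of a homomorphism and an antihomomorphism on $I$ if there exist a homomorphism $\varphi_1:I\to R_\varphi'$ and an antihomomorphism $\varphi_2:I\to R_\varphi'$ such that: (a) $\varphi|_I=\varphi_1+\varphi_2$; (b) $R_\varphi'$ has ideals $J_1$ and $J_2$ with $\varphi_1(I)\subseteq J_1$, $\varphi_2(I)\subseteq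 J_2$ and $J_1\cap J_2=\{0\}$; (c) $\varphi_1(ux)=\varphi_1(u)\varphi(x)$ and $\varphi_1(xu)=\varphi(x)\varphi_1(u)$ for all $u\in I$, $x\in R$; (d) $\varphi_2(ux)=\varphi(x)\varphi_2(u)$ and $\varphi_2(xu)=\varphi_2(u)\varphi(x)$ for all $u\in I$, $x\in R$. *)

theory Defs
  imports Complex_Main
begin

text \<open>
  The type class \<^class>\<open>ring\<close> consists of the associative rings that need not have a unit.
  The rings \<open>R\<close> and \<open>R'\<close> are types of this class; subrings and ideals are subsets.
\<close>

definition is_subring :: "'a::ring set \<Rightarrow> bool" where
  "is_subring S \<longleftrightarrow> 0 \<in> S \<and> (\<forall>x\<in>S. \<forall>y\<in>S. x - y \<in> S \<and> x * y \<in> S)"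

definition is_ideal :: "'a::ring set \<Rightarrow> 'a set \<Rightarrow> bool" where
  "is_ideal A J \<longleftrightarrow> J \<subseteq> A \<and> 0 \<in> J \<and> (\<forall>x\<in>J. \<forall>y\<in>J. x - y \<in> J) \<and>
     (\<forall>a\<in>A. \<forall>x\<in>J. a * x \<in> J \<and> x * a \<in> J)"

text \<open>
  If \<open>A\<close> is a subring and \<open>S \<subseteq> A\<close>, then \<open>is_ideal A hull S\<close> is the smallest ideal of \<open>A\<close>
  containing \<open>S\<close>. As \<open>A\<close> need not be unital, this is in general larger than the span of the
  products \<open>a * s * b\<close>.
\<close>

definition commutator_ideal :: "'a::ring set" where
  "commutator_ideal = is_ideal UNIV hull {x * y - y * x | x y. True}"

definition homomorphism_on :: "'a::ring set \<Rightarrow> ('a \<Rightarrow> 'b::ring) \<Rightarrow> bool" where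
  "homomorphism_on I f \<longleftrightarrow>
     (\<forall>x\<in>I. \<forall>y\<in>I. f (x + y) = f x + f y) \<and> (\<forall>x\<in>I. \<forall>y\<in>I. f (x * y) = f x * f y)"

definition antihomomorphism_on :: "'a::ring set \<Rightarrow> ('a \<Rightarrow> 'b::ring) \<Rightarrow> bool" where
  "antihomomorphism_on I f \<longleftrightarrow>
     (\<forall>x\<in>I. \<forall>y\<in>I. f (x + y) = f x + f y) \<and> (\<forall>x\<in>I. \<forall>y\<in>I. f (x * y) = f y * f x)"

definition jordan_homomorphism :: "('a::ring \<Rightarrow> 'b::ring) \<Rightarrow> bool" where
  "jordan_homomorphism \<phi> \<longleftrightarrow> additive \<phi> \<and>
     (\<forall>x. \<phi> (x * x) = \<phi> x * \<phi> x) \<and> (\<forall>x y. \<phi> (x * y * x) = \<phi> x * \<phi> y * \<phi> x)"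

definition image_subring :: "('a::ring \<Rightarrow> 'b::ring) \<Rightarrow> 'b set" where
  "image_subring \<phi> = is_subring hull range \<phi>"

definition V_ideal :: "('a::ring \<Rightarrow> 'b::ring) \<Rightarrow> 'b set" where
  "V_ideal \<phi> = is_ideal (image_subring \<phi>) hull {\<phi> (x * y) - \<phi> x * \<phi> y | x y. True}"

definition W_ideal :: "('a::ring \<Rightarrow> 'b::ring) \<Rightarrow> 'b set" where
  "W_ideal \<phi> = is_ideal (image_subring \<phi>) hull {\<phi> (x * y) - \<phi> y * \<phi> x | x y. True}"

definition splittable :: "('a::ring \<Rightarrow> 'b::ring) \<Rightarrow> bool" where
  "splittable \<phi> \<longleftrightarrow> V_ideal \<phi> \<inter> W_ideal \<phi> = {0}"

text \<open>
  Maps defined on \<open>I\<close> are represented by functions on the whole type whose values outside \<open>I\<close>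
  are irrelevant.
\<close>

definition sum_hom_antihom_on :: "'a::ring set \<Rightarrow> ('a \<Rightarrow> 'b::ring) \<Rightarrow> bool" where
  "sum_hom_antihom_on I \<phi> \<longleftrightarrow>
     (\<exists>\<phi>1 \<phi>2.
        homomorphism_on I \<phi>1 \<and> \<phi>1 ` I \<subseteq> image_subring \<phi> \<and>
        antihomomorphism_on I \<phi>2 \<and> \<phi>2 ` I \<subseteq> image_subring \<phi> \<and>
        (\<forall>u\<in>I. \<phi> u = \<phi>1 u + \<phi>2 u) \<and>
        (\<exists>J1 J2. is_ideal (image_subring \<phi>) J1 \<and> is_ideal (image_subring \<phi>) J2 \<and>
           \<phi>1 ` I \<subseteq> J1 \<and> \<phi>2 ` I \<subseteq> J2 \<and> J1 \<inter> J2 = {0}) \<and>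
        (\<forall>u\<in>I. \<forall>x. \<phi>1 (u * x) = \<phi>1 u * \<phi> x \<and> \<phi>1 (x * u) = \<phi> x * \<phi>1 u) \<and>
        (\<forall>u\<in>I. \<forall>x. \<phi>2 (u * x) = \<phi> x * \<phi>2 u \<and> \<phi>2 (x * u) = \<phi>2 u * \<phi> x))"

end

theory Submission imports Defs begin

text \<open>
  Modulo \<open>V\<close> the map \<open>\<phi>\<close> is a homomorphism, modulo \<open>W\<close> it is an antihomomorphism, and modulo
  \<open>V + W\<close> it is both, so \<open>{u. \<phi> u \<in> V + W}\<close> is an ideal of \<open>R\<close>. It contains the commutators, since
  \<open>\<phi> (x * y - y * x) = (\<phi> (x * y) - \<phi> y * \<phi> x) - (\<phi> (y * x) - \<phi> y * \<phi> x)\<close>. As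
  \<open>V \<inter> W = {0}\<close>, the components of \<open>\<phi> u\<close> in \<open>W\<close> and in \<open>V\<close> are unique; they are the values
  at \<open>u\<close> of the homomorphism and of the antihomomorphism.
\<close>

lemma is_subring_Inter:
  assumes "\<And>S. S \<in> F \<Longrightarrow> is_subring S"
  shows "is_subring (\<Inter>F)"
  using assms unfolding is_subring_def by blast

lemma is_subring_image_subring: "is_subring (image_subring \<phi>)"
  unfolding image_subring_def hull_def by (rule is_subring_Inter) simp

lemma in_image_subring: "\<phi> x \<in> image_subring \<phi>"
  unfolding image_subring_def using hull_subset[of "range \<phi>" is_subring] by blast

lemma is_subring_mult: "is_subring S \<Longrightarrow> x \<in> S \<Longrightarrow> y \<in> S \<Longrightarrow> x * y \<in> S"
  by (simp add: is_subring_def)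

lemma is_subring_diff: "is_subring S \<Longrightarrow> x \<in> S \<Longrightarrow> y \<in> S \<Longrightarrow> x - y \<in> S"
  by (simp add: is_subring_def)

lemma
  assumes "is_ideal A J"
  shows is_ideal_subset: "J \<subseteq> A"
    and is_ideal_zero: "0 \<in> J"
    and is_ideal_diff: "x \<in> J \<Longrightarrow> y \<in> J \<Longrightarrow> x - y \<in> J"
    and is_ideal_mult_left: "a \<in> A \<Longrightarrow> x \<in> J \<Longrightarrow> a * x \<in> J"
    and is_ideal_mult_right: "a \<in> A \<Longrightarrow> x \<in> J \<Longrightarrow> x * a \<in> J"
  using assms unfolding is_ideal_def by blast+

lemma is_ideal_add:
  assumes "is_ideal A J" "x \<in> J" "y \<in> J"
  shows "x + y \<in> J"
proof -
  have "x - (0 - y) \<in> J"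
    using assms by (intro is_ideal_diff is_ideal_zero)
  then show ?thesis by simp
qed

text \<open>The family must be nonempty: the empty intersection is \<open>UNIV\<close>, which need
  not lie inside \<open>A\<close>.\<close>

lemma is_ideal_Inter:
  assumes "F \<noteq> {}" "\<And>J. J \<in> F \<Longrightarrow> is_ideal A J"
  shows "is_ideal A (\<Inter>F)"
  unfolding is_ideal_def
proof (intro conjI ballI InterI)
  show "\<Inter>F \<subseteq> A"
    using assms is_ideal_subset by blast
qed (use assms(2) in \<open>auto dest: is_ideal_zero is_ideal_diff is_ideal_mult_left is_ideal_mult_right\<close>)

text \<open>The two assumptions make \<open>A\<close> itself an ideal of \<open>A\<close> containing
  \<open>S\<close>, so the hull is an intersection over a nonempty family.\<close>

lemma is_ideal_hull:
  assumes "is_subring A" "S \<subseteq> A"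
  shows "is_ideal A (is_ideal A hull S)"
proof -
  have "is_ideal A A"
    using assms(1) by (simp add: is_ideal_def is_subring_def)
  then show ?thesis
    using assms(2) unfolding hull_def by (intro is_ideal_Inter) auto
qed

lemma is_ideal_V_ideal: "is_ideal (image_subring \<phi>) (V_ideal \<phi>)"
  unfolding V_ideal_def
  by (rule is_ideal_hull)
    (auto intro!: is_subring_image_subring is_subring_diff is_subring_mult in_image_subring)

lemma is_ideal_W_ideal: "is_ideal (image_subring \<phi>) (W_ideal \<phi>)"
  unfolding W_ideal_def
  by (rule is_ideal_hull)
    (auto intro!: is_subring_image_subring is_subring_diff is_subring_mult in_image_subring)

lemma diff_mult_in_V_ideal: "\<phi> (x * y) - \<phi> x * \<phi> y \<in> V_ideal \<phi>"
  unfolding V_ideal_def by (rule hull_inc) blast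

lemma diff_mult_in_W_ideal: "\<phi> (x * y) - \<phi> y * \<phi> x \<in> W_ideal \<phi>"
  unfolding W_ideal_def by (rule hull_inc) blast

text \<open>The difference \<open>p - q\<close> lies in \<open>W\<close> and equals
  \<open>(a - q) - (a - p)\<close>, which lies in \<open>V\<close>.\<close>

lemma ideal_decomposition_unique:
  assumes V: "is_ideal A V" and W: "is_ideal A W" and VW: "V \<inter> W = {0}"
    and p: "p \<in> W" "a - p \<in> V" and q: "q \<in> W" "a - q \<in> V"
  shows "p = q"
proof -
  have "p - q \<in> W"
    using W p(1) q(1) by (rule is_ideal_diff)
  moreover have "(a - q) - (a - p) \<in> V"
    using V q(2) p(2) by (rule is_ideal_diff)
  ultimately have "p - q \<in> V \<inter> W" by simp
  with VW show ?thesis by simp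
qed

text \<open>The product falls into both ideals. This later removes the cross terms between the two
  components.\<close>

lemma mult_ideals_eq_0:
  assumes "is_ideal A I" "is_ideal A J" "I \<inter> J = {0}" "x \<in> I" "y \<in> J"
  shows "x * y = 0"
proof -
  have "x * y \<in> I \<inter> J"
    using is_ideal_mult_left[OF assms(2)] is_ideal_mult_right[OF assms(1)] assms(4,5)
      is_ideal_subset[OF assms(1)] is_ideal_subset[OF assms(2)] by blast
  with assms(3) show ?thesis by simp
qed

lemma commutator_ideal_decomposition:
  assumes "additive \<phi>" "u \<in> commutator_ideal"
  obtains p where "p \<in> W_ideal \<phi>" "\<phi> u - p \<in> V_ideal \<phi>"
proof -
  interpret additive \<phi> by fact
  note V = is_ideal_V_ideal[of \<phi>] and W = is_ideal_W_ideal[of \<phi>]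
  \<comment> \<open>This set is the preimage of \<open>W + V\<close> under \<phi>. Once it is an
    ideal containing the commutators, minimality of the hull finishes the proof.\<close>
  let ?I = "{u. \<exists>p\<in>W_ideal \<phi>. \<phi> u - p \<in> V_ideal \<phi>}"
  have comm: "x * y - y * x \<in> ?I" for x y
  proof -
    have "(0 - (\<phi> (y * x) - \<phi> y * \<phi> x)) \<in> V_ideal \<phi>"
      using V by (intro is_ideal_diff is_ideal_zero diff_mult_in_V_ideal)
    then have "\<phi> (x * y - y * x) - (\<phi> (x * y) - \<phi> y * \<phi> x) \<in> V_ideal \<phi>"
      by (simp add: diff algebra_simps)
    then show ?thesis
      using diff_mult_in_W_ideal by blast
  qed
  have "is_ideal UNIV ?I"
    unfolding is_ideal_def
  proof (intro conjI ballI)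
    show "?I \<subseteq> UNIV" by simp
    show "0 \<in> ?I"
      using is_ideal_zero[OF V] is_ideal_zero[OF W] by (auto simp: zero intro!: bexI[of _ 0])
  next
    fix u v assume "u \<in> ?I" "v \<in> ?I"
    then obtain p q where p: "p \<in> W_ideal \<phi>" "\<phi> u - p \<in> V_ideal \<phi>"
      and q: "q \<in> W_ideal \<phi>" "\<phi> v - q \<in> V_ideal \<phi>" by blast
    have "\<phi> (u - v) - (p - q) \<in> V_ideal \<phi>"
      using is_ideal_diff[OF V p(2) q(2)] by (simp add: diff algebra_simps)
    then show "u - v \<in> ?I"
      using is_ideal_diff[OF W p(1) q(1)] by blast
  next
    fix x u assume "u \<in> ?I"
    then obtain p where p: "p \<in> W_ideal \<phi>" "\<phi> u - p \<in> V_ideal \<phi>" by blast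
    \<comment> \<open>The sum telescopes to \<open>\<phi> (x * u) - \<phi> x * p\<close>, so
      \<open>\<phi> x * p\<close> is the witness in \<open>W\<close>.\<close>
    have "(\<phi> (x * u) - \<phi> x * \<phi> u) + \<phi> x * (\<phi> u - p) \<in> V_ideal \<phi>"
      by (intro is_ideal_add[OF V] is_ideal_mult_left[OF V] diff_mult_in_V_ideal in_image_subring p)
    then show "x * u \<in> ?I"
      using is_ideal_mult_left[OF W in_image_subring p(1)] by (auto simp: algebra_simps)
    have "(\<phi> (u * x) - \<phi> u * \<phi> x) + (\<phi> u - p) * \<phi> x \<in> V_ideal \<phi>"
      by (intro is_ideal_add[OF V] is_ideal_mult_right[OF V] diff_mult_in_V_ideal in_image_subring p)
    then show "u * x \<in> ?I"
      using is_ideal_mult_right[OF W in_image_subring p(1)] by (auto simp: algebra_simps)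
  qed
  then have "commutator_ideal \<subseteq> ?I"
    unfolding commutator_ideal_def by (rule hull_minimal[rotated]) (use comm in blast)
  with assms(2) that show thesis by blast
qed

theorem theorem3p13:
  fixes \<phi> :: "'a::ring \<Rightarrow> 'b::ring"
  assumes "jordan_homomorphism \<phi>"
    and "splittable \<phi>"
  shows "sum_hom_antihom_on (commutator_ideal :: 'a set) \<phi>"
proof -
  have additive: "additive \<phi>"
    using assms(1) by (simp add: jordan_homomorphism_def)
  note add = additive.add[OF additive]
  define A V W where "A = image_subring \<phi>" and "V = V_ideal \<phi>" and "W = W_ideal \<phi>"
  let ?K = "commutator_ideal :: 'a set"
  have V: "is_ideal A V" and W: "is_ideal A W" and VW: "V \<inter> W = {0}"
    using is_ideal_V_ideal is_ideal_W_ideal assms(2)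
    by (simp_all add: A_def V_def W_def splittable_def)
  have A: "\<phi> x \<in> A" for x
    by (simp add: A_def in_image_subring)
  have dV: "\<phi> (x * y) - \<phi> x * \<phi> y \<in> V" and dW: "\<phi> (x * y) - \<phi> y * \<phi> x \<in> W" for x y
    by (simp_all add: V_def W_def diff_mult_in_V_ideal diff_mult_in_W_ideal)
  have K: "is_ideal UNIV ?K"
    unfolding commutator_ideal_def by (rule is_ideal_hull) (auto simp: is_subring_def)
  \<comment> \<open>On the commutator ideal this choice exists and is unique, so \<open>f u\<close>
    is the \<open>W\<close>-component of \<open>\<phi> u\<close> and \<open>g u\<close> the
    \<open>V\<close>-component.\<close>
  define f where "f u = (SOME p. p \<in> W \<and> \<phi> u - p \<in> V)" for u
  define g where "g u = \<phi> u - f u" for u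
  have sum: "\<phi> u = f u + g u" for u
    by (simp add: g_def)
  have fg: "f u \<in> W \<and> g u \<in> V" if "u \<in> ?K" for u
    unfolding f_def g_def
    by (rule someI_ex)
      (use commutator_ideal_decomposition[OF additive that] in \<open>auto simp: V_def W_def\<close>)
  \<comment> \<open>This reduces each identity for \<open>f\<close> below to two memberships: the
    candidate is in \<open>W\<close>, the remainder in \<open>V\<close>.\<close>
  have f_eq: "f u = p" if "u \<in> ?K" "p \<in> W" "\<phi> u - p \<in> V" for u p
    using ideal_decomposition_unique[OF V W VW _ _ that(2,3)] fg[OF that(1)] by (simp add: g_def)
  \<comment> \<open>Here \<open>\<phi> u - q\<close> is a candidate for the
    \<open>W\<close>-component, hence equals \<open>f u\<close>.\<close>
  have g_eq: "g u = q" if "u \<in> ?K" "q \<in> V" "\<phi> u - q \<in> W" for u q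
    using f_eq[OF that(1,3)] that(2) by (simp add: g_def)
  have f_mult: "f (u * x) = f u * \<phi> x \<and> f (x * u) = \<phi> x * f u" if u: "u \<in> ?K" for u x
  proof
    \<comment> \<open>Since \<open>\<phi> u = f u + g u\<close>, this element of \<open>V\<close> is
      the remainder \<open>\<phi> (u * x) - f u * \<phi> x\<close>.\<close>
    have "(\<phi> (u * x) - \<phi> u * \<phi> x) + g u * \<phi> x \<in> V"
      using fg[OF u] by (intro is_ideal_add[OF V] is_ideal_mult_right[OF V] dV A) simp
    then show "f (u * x) = f u * \<phi> x"
      using is_ideal_mult_right[OF K UNIV_I u] is_ideal_mult_right[OF W A] fg[OF u]
      by (intro f_eq) (simp_all add: sum[of u] algebra_simps)
    have "(\<phi> (x * u) - \<phi> x * \<phi> u) + \<phi> x * g u \<in> V"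
      using fg[OF u] by (intro is_ideal_add[OF V] is_ideal_mult_left[OF V] dV A) simp
    then show "f (x * u) = \<phi> x * f u"
      using is_ideal_mult_left[OF K UNIV_I u] is_ideal_mult_left[OF W A] fg[OF u]
      by (intro f_eq) (simp_all add: sum[of u] algebra_simps)
  qed
  have g_mult: "g (u * x) = \<phi> x * g u \<and> g (x * u) = g u * \<phi> x" if u: "u \<in> ?K" for u x
  proof
    \<comment> \<open>For \<open>g\<close> the remainder must lie in \<open>W\<close>, where \<phi>
      is multiplicative up to reversing factors; hence the reversed order in
      \<open>g_mult\<close>.\<close>
    have "(\<phi> (u * x) - \<phi> x * \<phi> u) + \<phi> x * f u \<in> W"
      using fg[OF u] by (intro is_ideal_add[OF W] is_ideal_mult_left[OF W] dW A) simp
    then show "g (u * x) = \<phi> x * g u"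
      using is_ideal_mult_right[OF K UNIV_I u] is_ideal_mult_left[OF V A] fg[OF u]
      by (intro g_eq) (simp_all add: sum[of u] algebra_simps)
    have "(\<phi> (x * u) - \<phi> u * \<phi> x) + f u * \<phi> x \<in> W"
      using fg[OF u] by (intro is_ideal_add[OF W] is_ideal_mult_right[OF W] dW A) simp
    then show "g (x * u) = g u * \<phi> x"
      using is_ideal_mult_left[OF K UNIV_I u] is_ideal_mult_right[OF V A] fg[OF u]
      by (intro g_eq) (simp_all add: sum[of u] algebra_simps)
  qed
  have f_add: "f (u + v) = f u + f v" if "u \<in> ?K" "v \<in> ?K" for u v
  proof (rule f_eq)
    show "u + v \<in> ?K" "f u + f v \<in> W"
      using that fg is_ideal_add[OF K] is_ideal_add[OF W] by simp_all
    have "g u + g v \<in> V"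
      using that fg is_ideal_add[OF V] by simp
    then show "\<phi> (u + v) - (f u + f v) \<in> V"
      by (simp add: g_def add algebra_simps)
  qed
  have "homomorphism_on ?K f"
    unfolding homomorphism_on_def
  proof (intro conjI ballI)
    fix u v assume uv: "u \<in> ?K" "v \<in> ?K"
    show "f (u + v) = f u + f v"
      using uv by (rule f_add)
    \<comment> \<open>By \<open>f_mult\<close>,
      \<open>f (u * v) = f u * \<phi> v = f u * f v + f u * g v\<close>, and the last term
      vanishes.\<close>
    have "f u * g v = 0"
      using mult_ideals_eq_0[OF W V] VW uv fg by (simp add: Int_commute)
    then show "f (u * v) = f u * f v"
      using f_mult[OF uv(1)] sum[of v] by (simp add: distrib_left)
  qed
  moreover have "antihomomorphism_on ?K g"
    unfolding antihomomorphism_on_def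
  proof (intro conjI ballI)
    fix u v assume uv: "u \<in> ?K" "v \<in> ?K"
    show "g (u + v) = g u + g v"
      using f_add[OF uv] by (simp add: g_def add algebra_simps)
    \<comment> \<open>Likewise
      \<open>g (u * v) = \<phi> v * g u = f v * g u + g v * g u\<close>.\<close>
    have "f v * g u = 0"
      using mult_ideals_eq_0[OF W V] VW uv fg by (simp add: Int_commute)
    then show "g (u * v) = g v * g u"
      using g_mult[OF uv(1)] sum[of v] by (simp add: distrib_right)
  qed
  \<comment> \<open>The separating ideals are \<open>W\<close> for the homomorphism and
    \<open>V\<close> for the antihomomorphism.\<close>
  moreover have "W \<inter> V = {0}" "f ` ?K \<subseteq> W" "g ` ?K \<subseteq> V"
    using VW fg by auto
  moreover have "f ` ?K \<subseteq> A" "g ` ?K \<subseteq> A"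
    using calculation is_ideal_subset[OF V] is_ideal_subset[OF W] by auto
  ultimately show ?thesis
    unfolding sum_hom_antihom_on_def A_def[symmetric]
    using V W sum f_mult g_mult
    by (intro exI[of _ f] exI[of _ g] exI[of _ W] exI[of _ V] conjI ballI allI) simp_all
qed

end
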